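(* Let $(S,V,\mathcal{T})$ be a triangulated closed surface with a PL metric $d$, and let $\alpha\in\mathbb{R}$ be a constant such that $\alpha\chi(S)\le 0$. Let $\overline{R}:V\to\mathbb{R}$ be a given function. (1) If $\alpha\overline{R}\equiv 0$, then there exists at most one conformal factor $\overline{w}\in\Omega^{\mathcal{T}}(d)$ with combinatorial $\alpha$-curvature $\overline{R}$ up to scaling (that is, if $\overline{w}_A,\overline{w}_B\in\Omega^{\mathcal{T}}(d)$ both have combinatorial $\alpha$-curvature $\overline{R}$, then $\overline{w}_A=c\,\overline{w}_B$ for some constant $c>0$). (2) If $\alpha\overline{R}\le 0$ and $\alpha\overline{R}\not\equiv 0$, then there exists at most one conformal factor $\overline{w}\in\Omega^{\mathcal{T}}(d)$ with combinatorial $\alpha$-curvature $\overline{R}$.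
   Context: A marked surface $(S,V)$ is a closed connected surface $S$ with a nonempty finite subset $V=\{v_1,\dots,v_N\}\subset S$. A triangulated surface $(S,V,\mathcal{T})$ is a marked surface with a triangulation $\mathcal{T}=(V,E,F)$ with vertex set $V$, edge set $E$ and face set $F$. A piecewise linear (PL) metric on $(S,V)$ is a flat cone metric with cone points contained in $V$. A PL metric $d$ on $(S,V,\mathcal{T})$ is given by a map $d:E\to(0,+\infty)$ (edge lengths) satisfying the strict triangle inequalities $d_{rs}<d_{rt}+d_{st}$, $\{r,s,t\}=\{i,j,k\}$, for every triangle $\{i,j,k\}\in F$; every triangle is then realized as a Euclidean triangle. For $w:V\to(0,+\infty)$, the vertex scaling $w*d$ is given by $(w*d)_{ij}=w_iw_jd_{ij}$ for every edge $\{ij\}\in E$. $\Omega^{\mathcal{T}}(d)$ is the set of $w:V\to(0,+\infty)$ (conformal factors) such that $w*d$ satisfies the strict triangle inequalities on every face of $\mathcal{T}$. The combinatorial curvature of a PL metric at $v_i$ is $K_i=2\pi-\sum_{\triangle ijk\in F}\theta_i^{jk}$, where $\theta_i^{jk}$ is the inner angle at $v_i$ of the Euclidean triangle $\triangle ijk$. For $w\in\Omega^{\mathcal{T}}(d)$, the combinatorial $\alpha$-curvature of $w*d$ (also called the $\alpha$-curvature of $w$) is the function on $V$ given by $R_{\alpha,i}=K_i/w_i^{\alpha}$, where $K$ is the combinatorial curvature of $w*d$. $\chi(S)$ is the Euler characteristic. *)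

theory Defs
  imports "HOL-Analysis.Analysis" "HOL-Homology.Homology"
begin

section \<open>Closed surfaces and their triangulations\<close>

text \<open>
  No orientability is required.  Second countability follows from compactness and the
  local condition.
\<close>

definition closed_surface :: "'a topology \<Rightarrow> bool" where
  "closed_surface S \<longleftrightarrow>
     compact_space S \<and> Hausdorff_space S \<and>
     (\<forall>x\<in>topspace S. \<exists>U. openin S U \<and> x \<in> U \<and>
        subtopology S U homeomorphic_space Euclidean_space 2)"

definition marked_surface :: "'a topology \<Rightarrow> 'a set \<Rightarrow> bool" where
  "marked_surface S V \<longleftrightarrow>
     closed_surface S \<and> connected_space S \<and> finite V \<and> V \<noteq> {} \<and> V \<subseteq> topspace S"

text \<open>
  A triangulation with vertex set \<open>V\<close> is given by the set \<open>F\<close> of the characteristic maps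
  of its faces, that is, of maps from the standard 2-simplex to \<open>S\<close>.  Edges may be loops,
  two edges may have the same ends, and sides of one face may be glued to each other; a
  simplicial triangulation is the special case where faces and edges are determined by
  their vertices.  The corners and the sides of a face are numbered by 0, 1, 2, side \<open>k\<close>
  being opposite to corner \<open>k\<close>.
\<close>

type_synonym 'a face = "(nat \<Rightarrow> real) \<Rightarrow> 'a"

definition corner :: "'a face \<Rightarrow> nat \<Rightarrow> 'a" where
  "corner f k = f (\<lambda>i. if i = k then 1 else 0)"

definition side_of_triangle :: "nat \<Rightarrow> (nat \<Rightarrow> real) set" where
  "side_of_triangle k = {x \<in> standard_simplex 2. x k = 0}"

definition open_side_of_triangle :: "nat \<Rightarrow> (nat \<Rightarrow> real) set" where
  "open_side_of_triangle k = {x \<in> side_of_triangle k. \<forall>i\<le>2. i \<noteq> k \<longrightarrow> 0 < x i}"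

definition open_triangle :: "(nat \<Rightarrow> real) set" where
  "open_triangle = {x \<in> standard_simplex 2. \<forall>i\<le>2. 0 < x i}"

definition side :: "'a face \<Rightarrow> nat \<Rightarrow> 'a set" where
  "side f k = f ` side_of_triangle k"

text \<open>An edge is a closed edge, so the ends of an edge \<open>e\<close> are the points of \<open>e \<inter> V\<close>.\<close>

definition edges :: "'a face set \<Rightarrow> 'a set set" where
  "edges F = {side f k | f k. f \<in> F \<and> k \<le> 2}"

text \<open>
  The conditions say that the vertices, the open edges and the open faces are cells which
  partition \<open>S\<close>.  That the sides of the faces are glued in pairs is not an extra condition:
  it holds because \<open>S\<close> is a closed surface.
\<close>

definition triangulation :: "'a topology \<Rightarrow> 'a set \<Rightarrow> 'a face set \<Rightarrow> bool" where
  "triangulation S V F \<longleftrightarrow>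
     finite F \<and>
     (\<forall>f\<in>F. singular_simplex 2 S f) \<and>
     (\<Union>f\<in>F. f ` standard_simplex 2) = topspace S \<and>
     V = {corner f k | f k. f \<in> F \<and> k \<le> 2} \<and>
     (\<forall>f\<in>F. inj_on f open_triangle) \<and>
     (\<forall>f\<in>F. \<forall>k\<le>2. inj_on f (open_side_of_triangle k)) \<and>
     (\<forall>f\<in>F. \<forall>k\<le>2. f ` open_side_of_triangle k \<inter> V = {}) \<and>
     (\<forall>e\<in>edges F. \<forall>e'\<in>edges F. e \<noteq> e' \<longrightarrow> e \<inter> e' \<subseteq> V) \<and>
     (\<forall>f\<in>F. f ` open_triangle \<inter> (V \<union> \<Union>(edges F)) = {}) \<and>
     (\<forall>f\<in>F. \<forall>g\<in>F. f \<noteq> g \<longrightarrow> f ` open_triangle \<inter> g ` open_triangle = {})"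

definition triangulated_surface :: "'a topology \<Rightarrow> 'a set \<Rightarrow> 'a face set \<Rightarrow> bool" where
  "triangulated_surface S V F \<longleftrightarrow> marked_surface S V \<and> triangulation S V F"

text \<open>The Euler characteristic of the surface, computed from a triangulation.\<close>

definition euler_characteristic :: "'a set \<Rightarrow> 'a face set \<Rightarrow> int" where
  "euler_characteristic V F = int (card V) - int (card (edges F)) + int (card F)"

section \<open>Piecewise linear metrics and vertex scaling\<close>

definition triangle_inequalities :: "'a face set \<Rightarrow> ('a set \<Rightarrow> real) \<Rightarrow> bool" where
  "triangle_inequalities F d \<longleftrightarrow>
     (\<forall>f\<in>F. \<forall>r s t. {r, s, t} = {0, 1, 2} \<longrightarrow>
        d (side f r) < d (side f s) + d (side f t))"

text \<open>Only the values of \<open>d\<close> on \<open>edges F\<close> are relevant.\<close>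

definition PL_metric :: "'a face set \<Rightarrow> ('a set \<Rightarrow> real) \<Rightarrow> bool" where
  "PL_metric F d \<longleftrightarrow> (\<forall>e\<in>edges F. 0 < d e) \<and> triangle_inequalities F d"

text \<open>
  The length of an edge is multiplied by the factors at its two ends; a loop has both ends
  at the same vertex.
\<close>

definition vertex_scaling ::
    "'a set \<Rightarrow> ('a \<Rightarrow> real) \<Rightarrow> ('a set \<Rightarrow> real) \<Rightarrow> 'a set \<Rightarrow> real" where
  "vertex_scaling V w d e =
     (if card (e \<inter> V) = 1 then (\<Prod>v\<in>e \<inter> V. w v)\<^sup>2 else (\<Prod>v\<in>e \<inter> V. w v)) * d e"

text \<open>Only the values of \<open>w\<close> on \<open>V\<close> are relevant.\<close>

definition conformal_factors ::
    "'a set \<Rightarrow> 'a face set \<Rightarrow> ('a set \<Rightarrow> real) \<Rightarrow> ('a \<Rightarrow> real) set" where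
  "conformal_factors V F d =
     {w. (\<forall>v\<in>V. 0 < w v) \<and> triangle_inequalities F (vertex_scaling V w d)}"

section \<open>Combinatorial curvature\<close>

definition angle_at :: "complex \<Rightarrow> complex \<Rightarrow> complex \<Rightarrow> real" where
  "angle_at p q r = arccos (((q - p) \<bullet> (r - p)) / (norm (q - p) * norm (r - p)))"

text \<open>
  The inner angle opposite to the side of length \<open>a\<close> in a Euclidean triangle with side
  lengths \<open>a\<close>, \<open>b\<close>, \<open>c\<close>.
\<close>

definition inner_angle :: "real \<Rightarrow> real \<Rightarrow> real \<Rightarrow> real" where
  "inner_angle a b c =
     (THE t. \<exists>p q r. dist q r = a \<and> dist p r = b \<and> dist p q = c \<and> t = angle_at p q r)"

definition face_angle :: "('a set \<Rightarrow> real) \<Rightarrow> 'a face \<Rightarrow> nat \<Rightarrow> real" where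
  "face_angle d f k =
     inner_angle (d (side f k)) (d (side f ((k + 1) mod 3))) (d (side f ((k + 2) mod 3)))"

definition curvature :: "'a face set \<Rightarrow> ('a set \<Rightarrow> real) \<Rightarrow> 'a \<Rightarrow> real" where
  "curvature F d v =
     2 * pi - (\<Sum>(f, k) \<in> {(f, k). f \<in> F \<and> k \<le> 2 \<and> corner f k = v}. face_angle d f k)"

definition alpha_curvature ::
    "'a set \<Rightarrow> 'a face set \<Rightarrow> ('a set \<Rightarrow> real) \<Rightarrow> real \<Rightarrow> ('a \<Rightarrow> real) \<Rightarrow> 'a \<Rightarrow> real" where
  "alpha_curvature V F d \<alpha> w v = curvature F (vertex_scaling V w d) v / w v powr \<alpha>"

text \<open>The inner angle is well defined for every Euclidean triangle.\<close>

lemma angle_at_law_of_cosines: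
  assumes "dist q r = a" "dist p r = b" "dist p q = c"
  shows "angle_at p q r = arccos ((b\<^sup>2 + c\<^sup>2 - a\<^sup>2) / (2 * b * c))"
proof -
  have n: "norm (q - p) = c" "norm (r - p) = b"
    using assms by (auto simp: dist_norm norm_minus_commute)
  have "a\<^sup>2 = (norm ((q - p) - (r - p)))\<^sup>2"
    using assms by (simp add: dist_norm)
  also have "\<dots> = (norm (q - p))\<^sup>2 + (norm (r - p))\<^sup>2 - 2 * ((q - p) \<bullet> (r - p))"
    using dot_norm_neg[of "q - p" "r - p"] by argo
  also have "\<dots> = c\<^sup>2 + b\<^sup>2 - 2 * ((q - p) \<bullet> (r - p))"
    by (simp only: n)
  finally have i: "(q - p) \<bullet> (r - p) = (b\<^sup>2 + c\<^sup>2 - a\<^sup>2) / 2" by simp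
  show ?thesis unfolding angle_at_def n i by (simp add: mult_ac)
qed

lemma inner_angle_law_of_cosines:
  assumes pos: "0 < a" "0 < b" "0 < c" and tri: "a < b + c" "b < a + c" "c < a + b"
  shows "inner_angle a b c = arccos ((b\<^sup>2 + c\<^sup>2 - a\<^sup>2) / (2 * b * c))"
proof -
  define x where "x = (b\<^sup>2 + c\<^sup>2 - a\<^sup>2) / (2 * b * c)"
  have "a\<^sup>2 < (b + c)\<^sup>2" using pos tri by (intro power_strict_mono) auto
  moreover have "\<bar>b - c\<bar>\<^sup>2 < a\<^sup>2"
    using pos tri by (intro power_strict_mono) auto
  ultimately have x: "-1 \<le> x" "x \<le> 1"
    using pos by (auto simp: x_def field_simps power2_sum power2_diff)
  define r where "r = complex_of_real b * cis (arccos x)"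
  have "norm r = b" using pos by (simp add: r_def norm_mult)
  have "r \<bullet> complex_of_real c = b * c * x"
    using x by (simp add: r_def inner_complex_def cos_arccos)
  moreover have "(norm (complex_of_real c - r))\<^sup>2 =
      (norm (complex_of_real c))\<^sup>2 + (norm r)\<^sup>2 - 2 * (r \<bullet> complex_of_real c)"
    using dot_norm_neg[of r "complex_of_real c"]
    by (simp add: norm_minus_commute)
  ultimately have "(norm (complex_of_real c - r))\<^sup>2 = c\<^sup>2 + b\<^sup>2 - 2 * (b * c * x)"
    using \<open>norm r = b\<close> by simp
  also have "\<dots> = a\<^sup>2" using pos by (simp add: x_def field_simps)
  finally have "dist (complex_of_real c) r = a" using pos by (simp add: dist_norm)
  moreover have "dist 0 r = b" "dist 0 (complex_of_real c) = c"
    using pos \<open>norm r = b\<close> by (auto simp: dist_norm)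
  ultimately have d: "dist (complex_of_real c) r = a" "dist 0 r = b"
      "dist 0 (complex_of_real c) = c" by auto
  show ?thesis
    unfolding inner_angle_def
  proof (rule the_equality)
    show "\<exists>p q r. dist q r = a \<and> dist p r = b \<and> dist p q = c \<and>
        arccos ((b\<^sup>2 + c\<^sup>2 - a\<^sup>2) / (2 * b * c)) = angle_at p q r"
      by (intro exI conjI) (rule d angle_at_law_of_cosines[OF d, symmetric])+
  qed (metis angle_at_law_of_cosines)
qed

end

theory Submission
  imports Defs
begin

text \<open>
  Let \<open>x = ln (w' / w)\<close>. By the law of sines, the logarithms of the side lengths of a triangle
  are \<open>ln (sin \<theta>\<^sub>i)\<close> up to a common constant, so on each face \<open>\<Sum> (\<theta>'\<^sub>i - \<theta>\<^sub>i) x\<^sub>i\<close> equals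
  \<open>- \<Sum> (\<theta>'\<^sub>i - \<theta>\<^sub>i) (ln (sin \<theta>'\<^sub>i) - ln (sin \<theta>\<^sub>i))\<close>. The set of angle triples of triangles is
  convex, unlike the set of admissible conformal factors, and along a segment in it the
  derivative of the pairing is the form \<open>\<Sum> \<delta>\<^sub>i\<^sup>2 cot \<theta>\<^sub>i\<close>, which is positive definite on
  \<open>\<Sum> \<delta>\<^sub>i = 0\<close>; so no extension of the angle functions to degenerate triangles is needed.
  Summing over the faces, \<open>\<Sum> (K\<^sub>v - K'\<^sub>v) x\<^sub>v \<le> 0\<close>, with equality only if \<open>x\<close> is constant. But
  \<open>(K\<^sub>v - K'\<^sub>v) x\<^sub>v = R\<^sub>v (w\<^sub>v\<^sup>\<alpha> - w'\<^sub>v\<^sup>\<alpha>) x\<^sub>v \<ge> 0\<close> whenever \<open>\<alpha> R\<^sub>v \<le> 0\<close>.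
\<close>

section \<open>Trigonometry of a single Euclidean triangle\<close>

text \<open>By Heron's formula \<open>K\<close> is four times the area, so the sine formula says
  that the area is half of \<open>b * c\<close> times the sine. The factorization behind Heron's
  formula is also what makes \<open>1 - x\<^sup>2\<close> positive, which keeps the argument
  \<open>x\<close> of \<open>arccos\<close> strictly between -1 and 1.\<close>

lemma inner_angle_trig:
  fixes a b c :: real
  assumes pos: "0 < a" "0 < b" "0 < c" and tri: "a < b + c" "b < a + c" "c < a + b"
  defines "K \<equiv> sqrt ((a + b + c) * (b + c - a) * (a + c - b) * (a + b - c))"
  shows "cos (inner_angle a b c) = (b\<^sup>2 + c\<^sup>2 - a\<^sup>2) / (2 * b * c)"
    and "sin (inner_angle a b c) = K / (2 * b * c)"
    and "0 < K" and "0 < inner_angle a b c" and "inner_angle a b c < pi"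
proof -
  define x where "x = (b\<^sup>2 + c\<^sup>2 - a\<^sup>2) / (2 * b * c)"
  have A: "inner_angle a b c = arccos x"
    unfolding x_def using inner_angle_law_of_cosines[OF pos tri] .
  show K: "0 < K" unfolding K_def using pos tri by simp
  have "K\<^sup>2 = (a + b + c) * (b + c - a) * (a + c - b) * (a + b - c)"
    unfolding K_def using pos tri by simp
  also have "\<dots> = (2 * b * c)\<^sup>2 - (b\<^sup>2 + c\<^sup>2 - a\<^sup>2)\<^sup>2"
    by (simp add: algebra_simps power2_eq_square)
  also have "\<dots> = (2 * b * c)\<^sup>2 * (1 - x\<^sup>2)"
    using pos by (simp add: x_def power_divide right_diff_distrib)
  finally have Kx: "1 - x\<^sup>2 = (K / (2 * b * c))\<^sup>2"
    using pos by (simp add: power_divide)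
  have "0 < (K / (2 * b * c))\<^sup>2" using K pos by simp
  then have "x\<^sup>2 < 1" using Kx by linarith
  then have x: "-1 < x" "x < 1" by (auto simp: power2_less_1_iff abs_square_less_1)
  show "cos (inner_angle a b c) = (b\<^sup>2 + c\<^sup>2 - a\<^sup>2) / (2 * b * c)"
    unfolding A using x by (simp add: cos_arccos x_def)
  show "sin (inner_angle a b c) = K / (2 * b * c)"
    unfolding A using x K pos by (simp add: sin_arccos Kx)
  show "0 < inner_angle a b c" "inner_angle a b c < pi"
    unfolding A using x arccos_lt_bounded by auto
qed

text \<open>Because \<open>K\<close> is symmetric in the three sides, the addition formulas turn the
  cosine of \<open>A + B\<close> into minus that of \<open>C\<close>. Cosine is injective only on
  [0, pi], so \<open>A + B < pi\<close> has to be secured before the angles themselves can be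
  compared.\<close>

lemma inner_angle_sum:
  fixes a b c :: real
  assumes pos: "0 < a" "0 < b" "0 < c" and tri: "a < b + c" "b < a + c" "c < a + b"
  shows "inner_angle a b c + inner_angle b c a + inner_angle c a b = pi"
proof -
  define A where "A = inner_angle a b c"
  define B where "B = inner_angle b c a"
  define C where "C = inner_angle c a b"
  define K where "K = sqrt ((a + b + c) * (b + c - a) * (a + c - b) * (a + b - c))"
  have K2: "K\<^sup>2 = (a + b + c) * (b + c - a) * (a + c - b) * (a + b - c)"
    unfolding K_def using pos tri by simp
  note TA = inner_angle_trig[OF pos tri, folded A_def K_def]
  have TB: "cos B = (c\<^sup>2 + a\<^sup>2 - b\<^sup>2) / (2 * c * a)" "sin B = K / (2 * c * a)" "0 < B" "B < pi"
    using inner_angle_trig[of b c a] pos tri by (simp_all add: B_def K_def ac_simps)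
  have TC: "cos C = (a\<^sup>2 + b\<^sup>2 - c\<^sup>2) / (2 * a * b)" "sin C = K / (2 * a * b)" "0 < C" "C < pi"
    using inner_angle_trig[of c a b] pos tri by (simp_all add: C_def K_def ac_simps)
  have "cos (A + B) = ((b\<^sup>2 + c\<^sup>2 - a\<^sup>2) * (c\<^sup>2 + a\<^sup>2 - b\<^sup>2) - K\<^sup>2) / (4 * a * b * c\<^sup>2)"
    using pos by (simp add: cos_add TA TB field_simps power2_eq_square)
  also have "(b\<^sup>2 + c\<^sup>2 - a\<^sup>2) * (c\<^sup>2 + a\<^sup>2 - b\<^sup>2) - K\<^sup>2 = 2 * c\<^sup>2 * (c\<^sup>2 - a\<^sup>2 - b\<^sup>2)"
    unfolding K2 by (simp add: algebra_simps power2_eq_square)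
  also have "\<dots> / (4 * a * b * c\<^sup>2) = cos (pi - C)"
    using pos by (simp add: TC field_simps)
  finally have cosAB: "cos (A + B) = cos (pi - C)" .
  have "sin (A + B) = K * (2 * c\<^sup>2) / (4 * a * b * c\<^sup>2)"
    using pos by (simp add: sin_add TA TB field_simps power2_eq_square)
  then have "0 < sin (A + B)" using pos TA by simp
  \<comment> \<open>\<open>A + B\<close> is below 2 pi, and on [pi, 2 pi) the sine is not
    positive.\<close>
  then have "A + B < pi"
    using sin_le_zero[of "A + B"] TA TB by force
  then have "A + B = pi - C"
    using cosAB TA TB TC cos_inj_pi[of "A + B" "pi - C"] by simp
  then show ?thesis by (simp add: A_def B_def C_def)
qed

lemma law_of_sines:
  fixes a b c :: real
  assumes pos: "0 < a" "0 < b" "0 < c" and tri: "a < b + c" "b < a + c" "c < a + b"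
  obtains k where "0 < k" "a = k * sin (inner_angle a b c)"
    "b = k * sin (inner_angle b c a)" "c = k * sin (inner_angle c a b)"
proof
  define K where "K = sqrt ((a + b + c) * (b + c - a) * (a + c - b) * (a + b - c))"
  have K: "0 < K" and A: "sin (inner_angle a b c) = K / (2 * b * c)"
    using inner_angle_trig[OF pos tri] by (simp_all add: K_def)
  have B: "sin (inner_angle b c a) = K / (2 * c * a)"
    using inner_angle_trig[of b c a] pos tri by (simp add: K_def ac_simps)
  have C: "sin (inner_angle c a b) = K / (2 * a * b)"
    using inner_angle_trig[of c a b] pos tri by (simp add: K_def ac_simps)
  \<comment> \<open>As \<open>K\<close> is four times the area, this is the diameter of the
    circumscribed circle.\<close>
  let ?k = "2 * a * b * c / K"
  show "0 < ?k" "a = ?k * sin (inner_angle a b c)"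
    "b = ?k * sin (inner_angle b c a)" "c = ?k * sin (inner_angle c a b)"
    using pos K by (simp_all add: A B C)
qed

section \<open>Monotone dependence of the angles on the conformal factors\<close>

text \<open>In an obtuse triangle one cotangent is negative, so the terms cannot be estimated one by
  one. Instead, \<open>A + B + C = pi\<close> gives \<open>cot C * (x + y) = 1 - x * y\<close>, and
  multiplying the form by the positive number \<open>x + y\<close> makes it a sum of two
  squares.\<close>

lemma cot_quadratic_form_pos:
  fixes A B C p q r :: real
  assumes "0 < A" "0 < B" "0 < C" "A + B + C = pi" "p + q + r = 0" "\<not> (p = 0 \<and> q = 0)"
  shows "0 < p\<^sup>2 * cot A + q\<^sup>2 * cot B + r\<^sup>2 * cot C"
proof -
  have s: "0 < sin A" "0 < sin B" "0 < sin C"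
    using assms by (auto intro!: sin_gt_zero)
  have C: "C = pi - (A + B)" using assms by simp
  have sC: "sin C = sin A * cos B + cos A * sin B" unfolding C by (simp add: sin_add)
  have cC: "cos C = sin A * sin B - cos A * cos B" unfolding C by (simp add: cos_add)
  define x y where "x = cot A" and "y = cot B"
  have xy: "x + y = sin C / (sin A * sin B)"
    using s by (simp add: x_def y_def cot_def sC field_simps)
  then have xy_pos: "0 < x + y" using s by simp
  have cot_C: "cot C * (x + y) = 1 - x * y"
    using s by (simp add: xy) (simp add: x_def y_def cot_def cC field_simps)
  have r: "r = - (p + q)" using assms by simp
  have "(p\<^sup>2 * x + q\<^sup>2 * y + r\<^sup>2 * cot C) * (x + y) =
      (p\<^sup>2 * x + q\<^sup>2 * y) * (x + y) + r\<^sup>2 * (cot C * (x + y))"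
    by (simp add: algebra_simps)
  also have "\<dots> = (p * x - q * y)\<^sup>2 + (p + q)\<^sup>2"
    unfolding cot_C r by (simp add: algebra_simps power2_eq_square)
  also have "\<dots> > 0"
  \<comment> \<open>When \<open>p + q\<close> vanishes, only the first square is left, and it equals
    \<open>(p * (x + y))\<^sup>2\<close>.\<close>
  proof (cases "p + q = 0")
    case True
    then have "p \<noteq> 0" "p * x - q * y = p * (x + y)"
      using assms by (auto simp: algebra_simps eq_neg_iff_add_eq_0[symmetric])
    then show ?thesis using xy_pos by (simp add: True)
  qed (simp add: add_nonneg_pos)
  finally show ?thesis using xy_pos by (simp add: x_def y_def zero_less_mult_iff)
qed

lemma ln_sin_strictly_monotone:
  fixes A B C A' B' C' :: real
  assumes pos: "0 < A" "0 < B" "0 < C" "0 < A'" "0 < B'" "0 < C'"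
    and sum: "A + B + C = pi" "A' + B' + C' = pi"
    and ne: "\<not> (A = A' \<and> B = B')"
  shows "0 < (A' - A) * (ln (sin A') - ln (sin A)) + (B' - B) * (ln (sin B') - ln (sin B))
    + (C' - C) * (ln (sin C') - ln (sin C))"
proof -
  define p q r where "p = A' - A" and "q = B' - B" and "r = C' - C"
  \<comment> \<open>\<open>g\<close> pairs the fixed direction of the segment with the log-sines at
    its point \<open>t\<close>; the claim is \<open>g 0 < g 1\<close>, and the derivative of
    \<open>g\<close> is the cotangent form.\<close>
  define g where "g t = p * ln (sin (A + t * p)) + q * ln (sin (B + t * q))
    + r * ln (sin (C + t * r))" for t
  have pqr: "p + q + r = 0" using sum by (simp add: p_def q_def r_def)
  have seg: "0 < x + t * (y - x)" if "0 \<le> t" "t \<le> 1" "0 < x" "0 < y" for x y t :: real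
  proof -
    have "0 \<le> (1 - t) * x" "0 \<le> t * y" using that by simp_all
    moreover have "0 < (1 - t) * x \<or> 0 < t * y" using that by (cases "t = 0") auto
    moreover have "x + t * (y - x) = (1 - t) * x + t * y" by (simp add: algebra_simps)
    ultimately show ?thesis by linarith
  qed
  have seg_pos: "0 < A + t * p" "0 < B + t * q" "0 < C + t * r"
    and seg_sum: "(A + t * p) + (B + t * q) + (C + t * r) = pi"
    if "0 \<le> t" "t \<le> 1" for t
  proof -
    show "0 < A + t * p" "0 < B + t * q" "0 < C + t * r"
      unfolding p_def q_def r_def using seg that pos by auto
    have "(A + t * p) + (B + t * q) + (C + t * r) = (A + B + C) + t * (p + q + r)"
      by (simp add: algebra_simps)
    then show "(A + t * p) + (B + t * q) + (C + t * r) = pi" by (simp add: pqr sum)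
  qed
  have "g 0 < g 1"
  proof (rule DERIV_pos_imp_increasing[of 0 1 g])
    fix t :: real assume t: "0 \<le> t" "t \<le> 1"
    note P = seg_pos[OF t] and S = seg_sum[OF t]
    have s: "0 < sin (A + t * p)" "0 < sin (B + t * q)" "0 < sin (C + t * r)"
      using P S by (auto intro!: sin_gt_zero)
    have "(g has_real_derivative
        (p\<^sup>2 * cot (A + t * p) + q\<^sup>2 * cot (B + t * q) + r\<^sup>2 * cot (C + t * r))) (at t)"
      unfolding g_def using s
      by (auto intro!: derivative_eq_intros simp: cot_def field_simps power2_eq_square)
    moreover have "0 < p\<^sup>2 * cot (A + t * p) + q\<^sup>2 * cot (B + t * q) + r\<^sup>2 * cot (C + t * r)"
      using P S pqr ne by (intro cot_quadratic_form_pos) (auto simp: p_def q_def)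
    ultimately show "\<exists>y. (g has_real_derivative y) (at t) \<and> 0 < y" by blast
  qed simp
  then show ?thesis by (simp add: g_def p_def q_def r_def algebra_simps)
qed

text \<open>Here \<open>x\<close>, \<open>y\<close>, \<open>z\<close> are the logarithmic scalings
  at the corners opposite \<open>a\<close>, \<open>b\<close>, \<open>c\<close>, and each side picks
  up the two at its ends. Strict monotonicity of the log-sines on angle triples yields the sign of
  \<open>D\<close>; the equality case leaves only similar triangles.\<close>

lemma triangle_scaling_monotone:
  fixes a b c x y z :: real
  assumes pos: "0 < a" "0 < b" "0 < c" and tri: "a < b + c" "b < a + c" "c < a + b"
  defines "a' \<equiv> exp (y + z) * a" and "b' \<equiv> exp (z + x) * b" and "c' \<equiv> exp (x + y) * c"
  assumes tri': "a' < b' + c'" "b' < a' + c'" "c' < a' + b'"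
  defines "D \<equiv> (inner_angle a' b' c' - inner_angle a b c) * x
    + (inner_angle b' c' a' - inner_angle b c a) * y
    + (inner_angle c' a' b' - inner_angle c a b) * z"
  shows "D \<le> 0" and "D = 0 \<Longrightarrow> x = y \<and> y = z"
proof -
  have pos': "0 < a'" "0 < b'" "0 < c'" using pos by (simp_all add: a'_def b'_def c'_def)
  define A B C where "A = inner_angle a b c" and "B = inner_angle b c a"
    and "C = inner_angle c a b"
  define A' B' C' where "A' = inner_angle a' b' c'" and "B' = inner_angle b' c' a'"
    and "C' = inner_angle c' a' b'"
  note defs = A_def B_def C_def A'_def B'_def C'_def
  have sum: "A + B + C = pi" "A' + B' + C' = pi"
    using inner_angle_sum[OF pos tri] inner_angle_sum[OF pos' tri'] by (simp_all add: defs)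
  have ang: "0 < A" "0 < B" "0 < C" "0 < A'" "0 < B'" "0 < C'"
    using pos tri pos' tri' unfolding defs by (auto intro!: inner_angle_trig(4))
  then have s: "0 < sin A" "0 < sin B" "0 < sin C" "0 < sin A'" "0 < sin B'" "0 < sin C'"
    using sum by (auto intro!: sin_gt_zero)
  obtain k where k: "0 < k" "a = k * sin A" "b = k * sin B" "c = k * sin C"
    using law_of_sines[OF pos tri] unfolding defs by metis
  obtain k' where k': "0 < k'" "a' = k' * sin A'" "b' = k' * sin B'" "c' = k' * sin C'"
    using law_of_sines[OF pos' tri'] unfolding defs by metis
  \<comment> \<open>The change of the circumdiameter enters all three sides alike.\<close>
  define m where "m = ln k - ln k'"
  have "ln a' = y + z + ln a" "ln b' = z + x + ln b" "ln c' = x + y + ln c"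
    using pos by (simp_all add: a'_def b'_def c'_def ln_mult_pos)
  then have L: "ln (sin A') - ln (sin A) = y + z + m" "ln (sin B') - ln (sin B) = z + x + m"
      "ln (sin C') - ln (sin C) = x + y + m"
    using k k' s by (simp_all add: m_def ln_mult_pos)
  \<comment> \<open>Write \<open>y + z + m\<close> as \<open>(x + y + z + m) - x\<close>, and
    similarly for the others. The common part is multiplied by the sum of the angle differences,
    which is 0, so only \<open>- x\<close>, \<open>- y\<close>, \<open>- z\<close>
    contribute.\<close>
  have eq: "(A' - A) * (ln (sin A') - ln (sin A)) + (B' - B) * (ln (sin B') - ln (sin B))
    + (C' - C) * (ln (sin C') - ln (sin C)) = - D"
  proof -
    have C: "C = pi - A - B" "C' = pi - A' - B'" using sum by simp_all
    show ?thesis unfolding L D_def defs[symmetric] unfolding C by (simp add: algebra_simps)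
  qed
  show "D \<le> 0"
  proof (cases "A = A' \<and> B = B'")
    case True
    then have "C = C'" using sum by simp
    with True show ?thesis by (simp add: D_def defs[symmetric])
  next
    case False
    with ln_sin_strictly_monotone[OF ang sum] eq show ?thesis by simp
  qed
  assume "D = 0"
  then have "A = A' \<and> B = B'"
    using ln_sin_strictly_monotone[OF ang sum] eq by force
  moreover from this have "C = C'" using sum by simp
  \<comment> \<open>With equal angles the left sides in \<open>L\<close> vanish, so
    \<open>y + z\<close>, \<open>z + x\<close> and \<open>x + y\<close> all equal
    \<open>- m\<close>.\<close>
  ultimately show "x = y \<and> y = z" using L by simp
qed


section \<open>Cells of the triangulation and connectedness\<close>

lemma standard_simplex_2_cases:
  assumes "x \<in> standard_simplex 2"
  obtains "x \<in> open_triangle" | k where "k \<le> 2" "x \<in> open_side_of_triangle k"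
    | k where "k \<le> 2" "x = (\<lambda>i. if i = k then 1 else 0)"
proof -
  have nn: "0 \<le> x i" for i using assms by (simp add: standard_simplex_def)
  have out: "x i = 0" if "2 < i" for i using assms that by (simp add: standard_simplex_def)
  have sum: "x 0 + x 1 + x 2 = 1"
    using assms by (simp add: standard_simplex_def numeral_2_eq_2)
  have le2: "i \<le> 2 \<longleftrightarrow> i = 0 \<or> i = 1 \<or> i = 2" for i :: nat by auto
  have vertex: "x = (\<lambda>i. if i = k then 1 else 0)" if "k \<le> 2" "\<forall>i\<le>2. i \<noteq> k \<longrightarrow> x i = 0" for k
  proof
    fix i
    have "k = 0 \<or> k = 1 \<or> k = 2" using that(1) le2 by blast
    then have "x k = 1" using that(2) sum by (elim disjE) simp_all
    then show "x i = (if i = k then 1 else 0)"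
      using that out[of i] by (cases "i \<le> 2") auto
  qed
  \<comment> \<open>The number of zero coordinates decides the cell: none for the interior, one for
    an open side, at least two for a corner.\<close>
  consider "\<forall>i\<le>2. 0 < x i" | k where "k \<le> 2" "x k = 0" "\<forall>i\<le>2. i \<noteq> k \<longrightarrow> 0 < x i"
    | k where "k \<le> 2" "\<forall>i\<le>2. i \<noteq> k \<longrightarrow> x i = 0"
  proof -
    have "(0 < x 0 \<or> x 0 = 0) \<and> (0 < x 1 \<or> x 1 = 0) \<and> (0 < x 2 \<or> x 2 = 0)"
      using nn by (metis less_eq_real_def)
    then show thesis
      using that(1) that(2)[of 0] that(2)[of 1] that(2)[of 2]
        that(3)[of 0] that(3)[of 1] that(3)[of 2] unfolding le2 by auto
  qed
  then show thesis
  proof cases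
    case 1
    then show thesis using that(1) assms by (simp add: open_triangle_def)
  next
    case 2
    then show thesis
      using that(2) assms by (simp add: open_side_of_triangle_def side_of_triangle_def)
  next
    case 3
    then show thesis using that(3) vertex by blast
  qed
qed

lemma vertex_in_standard_simplex:
  "k \<le> p \<Longrightarrow> (\<lambda>i. if i = k then 1 else 0) \<in> standard_simplex p"
  by (simp add: standard_simplex_def sum.delta)

lemma triangulationD:
  assumes "triangulation S V F"
  shows "V = {corner f k | f k. f \<in> F \<and> k \<le> 2}"
    and "f \<in> F \<Longrightarrow> k \<le> 2 \<Longrightarrow> f ` open_side_of_triangle k \<inter> V = {}"
    and "e \<in> edges F \<Longrightarrow> e' \<in> edges F \<Longrightarrow> e \<noteq> e' \<Longrightarrow> e \<inter> e' \<subseteq> V"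
    and "f \<in> F \<Longrightarrow> f ` open_triangle \<inter> (V \<union> \<Union> (edges F)) = {}"
    and "f \<in> F \<Longrightarrow> g \<in> F \<Longrightarrow> f \<noteq> g \<Longrightarrow> f ` open_triangle \<inter> g ` open_triangle = {}"
proof -
  note conj = assms[unfolded triangulation_def]
  show "V = {corner f k | f k. f \<in> F \<and> k \<le> 2}"
    using conj by (elim conjE)
  have "\<forall>f\<in>F. \<forall>k\<le>2. f ` open_side_of_triangle k \<inter> V = {}"
    using conj by (elim conjE)
  then show "f \<in> F \<Longrightarrow> k \<le> 2 \<Longrightarrow> f ` open_side_of_triangle k \<inter> V = {}" by simp
  have "\<forall>e\<in>edges F. \<forall>e'\<in>edges F. e \<noteq> e' \<longrightarrow> e \<inter> e' \<subseteq> V"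
    using conj by (elim conjE)
  then show "e \<in> edges F \<Longrightarrow> e' \<in> edges F \<Longrightarrow> e \<noteq> e' \<Longrightarrow> e \<inter> e' \<subseteq> V" by simp
  have "\<forall>f\<in>F. f ` open_triangle \<inter> (V \<union> \<Union> (edges F)) = {}"
    using conj by (elim conjE)
  then show "f \<in> F \<Longrightarrow> f ` open_triangle \<inter> (V \<union> \<Union> (edges F)) = {}" by (rule bspec)
  have "\<forall>f\<in>F. \<forall>g\<in>F. f \<noteq> g \<longrightarrow> f ` open_triangle \<inter> g ` open_triangle = {}"
    using conj by (elim conjE)
  then show "f \<in> F \<Longrightarrow> g \<in> F \<Longrightarrow> f \<noteq> g \<Longrightarrow> f ` open_triangle \<inter> g ` open_triangle = {}" by simp
qed

lemma corner_in_vertices: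
  assumes "triangulation S V F" "f \<in> F" "k \<le> 2"
  shows "corner f k \<in> V"
  unfolding triangulationD(1)[OF assms(1)] using assms(2,3) by blast

text \<open>Open faces and open sides avoid \<open>V\<close>, which leaves only the corners.\<close>

lemma vertex_of_face_is_corner:
  assumes tri: "triangulation S V F" and f: "f \<in> F" and x: "x \<in> standard_simplex 2"
    and "f x \<in> V"
  obtains k where "k \<le> 2" "x = (\<lambda>i. if i = k then 1 else 0)"
  using x
proof (cases rule: standard_simplex_2_cases)
  case 1
  then show thesis using triangulationD(4)[OF tri f] \<open>f x \<in> V\<close> by blast
next
  case (2 k)
  then show thesis using triangulationD(2)[OF tri f] \<open>f x \<in> V\<close> by blast
qed (use that in blast)

text \<open>This links an edge as a point set, the form in which \<open>vertex_scaling\<close> sees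
  it, to the numbered corners of a face. For a loop the two corners are the same point.\<close>

lemma ends_of_side:
  assumes tri: "triangulation S V F" and f: "f \<in> F" and rst: "{r, s, t} = {0, 1, 2}"
  shows "side f r \<inter> V = {corner f s, corner f t}"
proof
  have rst': "r \<noteq> s" "r \<noteq> t" "s \<le> 2" "t \<le> 2" and le2: "k \<le> 2 \<Longrightarrow> k = r \<or> k = s \<or> k = t" for k
  proof -
    \<comment> \<open>Three names for a set of three elements must be distinct.\<close>
    have "card {r, s, t} = 3" unfolding rst by simp
    then show "r \<noteq> s" "r \<noteq> t" by (auto simp: card_insert_if split: if_splits)
    have "s \<in> {0, 1, 2}" "t \<in> {0, 1, 2}" using rst by blast+
    then show "s \<le> 2" "t \<le> 2" by auto
    assume "k \<le> 2"
    then have "k \<in> {0, 1, 2}" by auto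
    then show "k = r \<or> k = s \<or> k = t" unfolding rst[symmetric] by simp
  qed
  show "side f r \<inter> V \<subseteq> {corner f s, corner f t}"
  proof
    fix p assume p: "p \<in> side f r \<inter> V"
    then obtain x where x: "x \<in> standard_simplex 2" "x r = 0" "p = f x"
      by (auto simp: side_def side_of_triangle_def)
    obtain k where k: "k \<le> 2" "x = (\<lambda>i. if i = k then 1 else 0)"
      using vertex_of_face_is_corner[OF tri f x(1)] p x by blast
    then have "k \<noteq> r" using x by auto
    then show "p \<in> {corner f s, corner f t}" using le2[OF k(1)] k x by (auto simp: corner_def)
  qed
  show "{corner f s, corner f t} \<subseteq> side f r \<inter> V"
  proof
    fix p assume "p \<in> {corner f s, corner f t}"
    then obtain k where k: "k \<le> 2" "k \<noteq> r" "p = corner f k" using rst' by blast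
    then have "(\<lambda>i. if i = k then 1 else 0) \<in> side_of_triangle r"
      using vertex_in_standard_simplex[of k 2] by (simp add: side_of_triangle_def)
    then have "p \<in> side f r" unfolding side_def k corner_def by (rule imageI)
    moreover have "p \<in> V" using corner_in_vertices[OF tri f] k by simp
    ultimately show "p \<in> side f r \<inter> V" by simp
  qed
qed

text \<open>The square that the definition uses for a loop is the product over its two coinciding
  corners, so one formula covers both kinds of edges.\<close>

lemma vertex_scaling_side:
  assumes "triangulation S V F" "f \<in> F" "{r, s, t} = {0, 1, 2}"
  shows "vertex_scaling V w d (side f r) = w (corner f s) * w (corner f t) * d (side f r)"
  using ends_of_side[OF assms]
  by (cases "corner f s = corner f t") (simp_all add: vertex_scaling_def power2_eq_square)

text \<open>A common point is a vertex, an inner point of both faces, or a point of an edge of both.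
  In the second case the faces coincide; in the third the two edges coincide and hence have the same
  ends.\<close>

lemma faces_meet_in_corner:
  assumes tri: "triangulation S V F" and fg: "f \<in> F" "g \<in> F"
    and ab: "a \<in> standard_simplex 2" "b \<in> standard_simplex 2" and p: "f a = g b"
  obtains j k where "j \<le> 2" "k \<le> 2" "corner f j = corner g k"
proof (cases "f a \<in> V")
  case True
  obtain j where "j \<le> 2" "a = (\<lambda>i. if i = j then 1 else 0)"
    using vertex_of_face_is_corner[OF tri fg(1) ab(1) True] .
  moreover obtain k where "k \<le> 2" "b = (\<lambda>i. if i = k then 1 else 0)"
    using vertex_of_face_is_corner[OF tri fg(2) ab(2)] True p by metis
  ultimately show thesis using that p by (simp add: corner_def)
next
  case False
  have cell: "x \<in> open_triangle \<or> (\<exists>k\<le>2. h x \<in> side h k)"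
    if "h \<in> F" "x \<in> standard_simplex 2" "h x \<notin> V" for h x
    using that(2)
  proof (cases rule: standard_simplex_2_cases)
    case (2 k)
    then show ?thesis unfolding side_def open_side_of_triangle_def by blast
  next
    case (3 k)
    then have "h x \<in> V" using corner_in_vertices[OF tri that(1)] by (simp add: corner_def)
    with that show ?thesis by simp
  qed simp
  \<comment> \<open>This rules out the mixed case, a point inside one face and on a side of the
    other.\<close>
  have open_side: False
    if "h \<in> F" "g \<in> F" "x \<in> open_triangle" "h x \<in> side g k" "k \<le> 2" for h g x k
  proof -
    have "h x \<in> \<Union> (edges F)" using that by (auto simp: edges_def)
    then show False using triangulationD(4)[OF tri that(1)] that(3) by blast
  qed
  consider "a \<in> open_triangle" "b \<in> open_triangle"
    | i j where "i \<le> 2" "j \<le> 2" "f a \<in> side f i" "f a \<in> side g j"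
    using cell[OF fg(1) ab(1) False] cell[OF fg(2) ab(2)] False p
      open_side[OF fg(1,2)] open_side[OF fg(2,1)] by metis
  then show thesis
  proof cases
    case 1
    then have "f = g" using triangulationD(5)[OF tri fg] p by blast
    then show thesis using that[of 0 0] by simp
  next
    case 2
    have "side f i \<in> edges F" "side g j \<in> edges F" using fg 2 by (auto simp: edges_def)
    moreover have "\<not> side f i \<inter> side g j \<subseteq> V" using 2 False by blast
    ultimately have eq: "side f i = side g j" using triangulationD(3)[OF tri] by blast
    have perm: "\<exists>s t. {k, s, t} = {0, 1, 2} \<and> s \<le> 2 \<and> t \<le> 2" if "k \<le> 2" for k :: nat
    proof -
      have "{0, 1, 2} = {0, 1, 2::nat}" "{1, 2, 0} = {0, 1, 2::nat}" "{2, 0, 1} = {0, 1, 2::nat}"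
        by auto
      moreover have "k = 0 \<or> k = 1 \<or> k = 2" using that by auto
      ultimately show ?thesis by (metis le_numeral_extra(3) one_le_numeral order_refl zero_le)
    qed
    obtain s t where st: "{i, s, t} = {0, 1, 2}" "s \<le> 2" using perm 2(1) by blast
    obtain s' t' where st': "{j, s', t'} = {0, 1, 2}" "s' \<le> 2" "t' \<le> 2" using perm 2(2) by blast
    have "corner f s \<in> {corner g s', corner g t'}"
      using ends_of_side[OF tri fg(1) st(1)] ends_of_side[OF tri fg(2) st'(1)] eq by blast
    then show thesis using that st st' by blast
  qed
qed

text \<open>Otherwise the faces on which \<open>y\<close> takes the value \<open>y u\<close> and the
  remaining faces form two nonempty closed sets covering \<open>S\<close>. They are disjoint, since
  faces that meet share a corner, and this contradicts connectedness.\<close>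

lemma constant_on_faces_imp_constant:
  assumes surf: "triangulated_surface S V F"
    and y: "\<And>f j k. f \<in> F \<Longrightarrow> j \<le> 2 \<Longrightarrow> k \<le> 2 \<Longrightarrow> y (corner f j) = y (corner f k)"
    and uv: "u \<in> V" "v \<in> V"
  shows "y u = y v"
proof (rule ccontr)
  assume ne: "y u \<noteq> y v"
  have tri: "triangulation S V F" and marked: "marked_surface S V"
    using surf by (auto simp: triangulated_surface_def)
  have haus: "Hausdorff_space S" and conn: "connected_space S"
    using marked by (auto simp: marked_surface_def closed_surface_def)
  have fin: "finite F" and cover: "(\<Union>f\<in>F. f ` standard_simplex 2) = topspace S"
    using tri by (auto simp: triangulation_def)
  have closed_face: "closedin S (f ` standard_simplex 2)" if "f \<in> F" for f
  proof -
    have "continuous_map (subtopology (powertop_real UNIV) (standard_simplex 2)) S f"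
      using tri that by (auto simp: triangulation_def singular_simplex_def)
    then have "compactin S (f ` standard_simplex 2)"
      by (intro image_compactin) (auto simp: compactin_subtopology compactin_standard_simplex)
    then show ?thesis using haus compactin_imp_closedin by blast
  qed
  \<comment> \<open>Corner 0 may represent its face because \<open>y\<close> agrees on all corners
    of a face.\<close>
  define G where "G = {f \<in> F. y (corner f 0) = y u}"
  define P where "P H = (\<Union>f\<in>H. f ` standard_simplex 2)" for H :: "'a face set"
  have "closedin S (P G)" "closedin S (P (F - G))"
    unfolding P_def using fin closed_face by (auto simp: G_def intro!: closedin_Union)
  moreover have "topspace S \<subseteq> P G \<union> P (F - G)"
    unfolding cover[symmetric] P_def by (auto simp: G_def)
  moreover have "P G \<inter> P (F - G) = {}"
  proof (rule ccontr)
    assume "P G \<inter> P (F - G) \<noteq> {}"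
    then obtain f g a b where fg: "f \<in> G" "g \<in> F - G" "a \<in> standard_simplex 2"
        "b \<in> standard_simplex 2" "f a = g b"
      unfolding P_def by auto
    then have F: "f \<in> F" "g \<in> F" by (auto simp: G_def)
    obtain j k where "j \<le> 2" "k \<le> 2" "corner f j = corner g k"
      using faces_meet_in_corner[OF tri F fg(3,4,5)] .
    then have "y (corner f 0) = y (corner g 0)"
      using y[OF F(1), of 0 j] y[OF F(2), of 0 k] by simp
    then show False using fg by (auto simp: G_def)
  qed
  moreover have vertex_face: "\<exists>f\<in>F. y (corner f 0) = y w \<and> w \<in> f ` standard_simplex 2"
    if "w \<in> V" for w
  proof -
    have "w \<in> {corner f k | f k. f \<in> F \<and> k \<le> 2}"
      by (subst triangulationD(1)[OF tri, symmetric]) (rule that)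
    then obtain f k where "f \<in> F" "k \<le> 2" "w = corner f k" by blast
    then show ?thesis
      using y[of f 0 k] vertex_in_standard_simplex[of k 2] by (auto simp: corner_def)
  qed
  have "P G \<noteq> {}" using vertex_face[OF uv(1)] by (auto simp: P_def G_def)
  moreover have "P (F - G) \<noteq> {}" using vertex_face[OF uv(2)] ne by (auto simp: P_def G_def)
  ultimately show False using conn unfolding connected_space_closedin by blast
qed

section \<open>Summation over the surface and rigidity\<close>

text \<open>The terms 2 pi cancel, and the pairs of a face and a corner number are grouped by the
  vertex at that corner. Curvature contains the angles with a minus sign, hence the exchanged order
  of \<open>l\<close> and \<open>l'\<close> on the right.\<close>

lemma sum_curvature:
  assumes tri: "triangulation S V F" and V: "finite V"
  shows "(\<Sum>v\<in>V. (curvature F l v - curvature F l' v) * x v)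
    = (\<Sum>f\<in>F. \<Sum>k\<le>2. (face_angle l' f k - face_angle l f k) * x (corner f k))"
proof -
  define h where "h = (\<lambda>(f, k). (face_angle l' f k - face_angle l f k) * x (corner f k))"
  define c :: "'a face \<times> nat \<Rightarrow> 'a" where "c = (\<lambda>(f, k). corner f k)"
  let ?T = "F \<times> {..2}"
  have fin: "finite F" using tri by (simp add: triangulation_def)
  have c: "c ` ?T \<subseteq> V" using corner_in_vertices[OF tri] by (auto simp: c_def)
  have "(curvature F l v - curvature F l' v) * x v = sum h {p \<in> ?T. c p = v}" for v
  proof -
    have T: "{(f, k). f \<in> F \<and> k \<le> 2 \<and> corner f k = v} = {p \<in> ?T. c p = v}"
      by (auto simp: c_def)
    have "(curvature F l v - curvature F l' v) * x v =
        (\<Sum>p\<in>{p \<in> ?T. c p = v}. ((case p of (f, k) \<Rightarrow> face_angle l' f k)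
          - (case p of (f, k) \<Rightarrow> face_angle l f k)) * x v)"
      unfolding curvature_def T sum_subtractf sum_distrib_right[symmetric] by simp
    also have "\<dots> = sum h {p \<in> ?T. c p = v}"
      by (rule sum.cong) (auto simp: h_def c_def)
    finally show ?thesis .
  qed
  then have "(\<Sum>v\<in>V. (curvature F l v - curvature F l' v) * x v)
      = (\<Sum>v\<in>V. sum h {p \<in> ?T. c p = v})" by simp
  also have "\<dots> = sum h ?T"
    using fin V c by (intro sum.group) auto
  finally show ?thesis by (simp add: sum.cartesian_product h_def)
qed

lemma face_scaling_monotone:
  assumes tri: "triangulation S V F" and d: "PL_metric F d" and f: "f \<in> F"
    and w: "w \<in> conformal_factors V F d" and w': "w' \<in> conformal_factors V F d"
  defines "l \<equiv> vertex_scaling V w d" and "l' \<equiv> vertex_scaling V w' d"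
    and "x \<equiv> \<lambda>v. ln (w' v) - ln (w v)"
  defines "D \<equiv> (\<Sum>k\<le>2. (face_angle l' f k - face_angle l f k) * x (corner f k))"
  shows "D \<le> 0"
    and "D = 0 \<Longrightarrow> j \<le> 2 \<Longrightarrow> k \<le> 2 \<Longrightarrow> x (corner f j) = x (corner f k)"
proof -
  have V: "corner f k \<in> V" if "k \<le> 2" for k
    using corner_in_vertices[OF tri f that] .
  have pos: "0 < w (corner f k)" "0 < w' (corner f k)" if "k \<le> 2" for k
    using V[OF that] w w' by (auto simp: conformal_factors_def)
  have d_pos: "0 < d (side f k)" if "k \<le> 2" for k
    using d f that by (auto simp: PL_metric_def edges_def)
  have rst: "{0, 1, 2} = {0, 1, 2::nat}" "{1, 2, 0} = {0, 1, 2::nat}" "{2, 0, 1} = {0, 1, 2::nat}"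
    by auto
  note scale = rst[THEN vertex_scaling_side[OF tri f]]
  have l_pos: "0 < l (side f 0)" "0 < l (side f 1)" "0 < l (side f 2)"
    unfolding l_def scale by (auto intro!: mult_pos_pos pos d_pos)
  have w'_eq: "w' (corner f k) = exp (x (corner f k)) * w (corner f k)" if "k \<le> 2" for k
    using pos[OF that] by (simp add: x_def exp_diff)
  have l': "l' (side f 0) = exp (x (corner f 1) + x (corner f 2)) * l (side f 0)"
      "l' (side f 1) = exp (x (corner f 2) + x (corner f 0)) * l (side f 1)"
      "l' (side f 2) = exp (x (corner f 0) + x (corner f 1)) * l (side f 2)"
    unfolding l_def l'_def scale by (simp_all add: w'_eq exp_add)
  have ineq: "m (side f 0) < m (side f 1) + m (side f 2)"
      "m (side f 1) < m (side f 0) + m (side f 2)"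
      "m (side f 2) < m (side f 0) + m (side f 1)" if "triangle_inequalities F m" for m
  proof -
    have tr: "m (side f r) < m (side f s) + m (side f t)" if "{r, s, t} = {0, 1, 2}" for r s t
      using \<open>triangle_inequalities F m\<close> f that unfolding triangle_inequalities_def by blast
    show "m (side f 0) < m (side f 1) + m (side f 2)" by (rule tr) auto
    show "m (side f 1) < m (side f 0) + m (side f 2)" by (rule tr) auto
    show "m (side f 2) < m (side f 0) + m (side f 1)" by (rule tr) auto
  qed
  have tl: "triangle_inequalities F l" "triangle_inequalities F l'"
    using w w' by (auto simp: conformal_factors_def l_def l'_def)
  \<comment> \<open>The variables still free occur in the order \<open>y\<close>, \<open>z\<close>,
    \<open>x\<close>, hence corners 1, 2, 0: corner \<open>k\<close> is opposite to side
    \<open>k\<close>, and sides 0, 1, 2 are \<open>a\<close>, \<open>b\<close>,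
    \<open>c\<close>.\<close>
  note mono = triangle_scaling_monotone[OF l_pos ineq[OF tl(1)],
      of "x (corner f 1)" "x (corner f 2)" "x (corner f 0)", folded l', OF ineq[OF tl(2)]]
  have D: "D = (inner_angle (l' (side f 0)) (l' (side f 1)) (l' (side f 2))
        - inner_angle (l (side f 0)) (l (side f 1)) (l (side f 2))) * x (corner f 0)
      + (inner_angle (l' (side f 1)) (l' (side f 2)) (l' (side f 0))
        - inner_angle (l (side f 1)) (l (side f 2)) (l (side f 0))) * x (corner f 1)
      + (inner_angle (l' (side f 2)) (l' (side f 0)) (l' (side f 1))
        - inner_angle (l (side f 2)) (l (side f 0)) (l (side f 1))) * x (corner f 2)"
    unfolding D_def by (simp add: numeral_2_eq_2 face_angle_def)
  show "D \<le> 0" using mono(1) unfolding D .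
  assume "D = 0" "j \<le> 2" "k \<le> 2"
  then have "j = 0 \<or> j = 1 \<or> j = 2" "k = 0 \<or> k = 1 \<or> k = 2" by auto
  then show "x (corner f j) = x (corner f k)"
    using mono(2) \<open>D = 0\<close> unfolding D by auto
qed

text \<open>The function sending \<open>t\<close> to \<open>r * t powr \<alpha>\<close> has a
  derivative with the sign of \<open>\<alpha> * r\<close>, so it is nonincreasing while
  \<open>ln\<close> increases; it is injective if \<open>\<alpha> * r\<close> is nonzero.\<close>

lemma power_difference_sign:
  fixes r \<alpha> a b :: real
  assumes "0 < a" "0 < b" and r: "\<alpha> * r \<le> 0"
  shows "0 \<le> (r * a powr \<alpha> - r * b powr \<alpha>) * (ln b - ln a)"
    and "(r * a powr \<alpha> - r * b powr \<alpha>) * (ln b - ln a) = 0 \<Longrightarrow> \<alpha> * r \<noteq> 0 \<Longrightarrow> a = b"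
proof -
  consider "\<alpha> = 0" | "0 < \<alpha>" "r \<le> 0" | "\<alpha> < 0" "0 \<le> r"
    using r by (cases \<alpha> "0 :: real" rule: linorder_cases) (auto simp: mult_le_0_iff)
  then show "0 \<le> (r * a powr \<alpha> - r * b powr \<alpha>) * (ln b - ln a)"
  proof cases
    case 1
    then show ?thesis using assms by simp
  next
    case 2
    then show ?thesis
      using assms powr_mono2[of \<alpha> a b] powr_mono2[of \<alpha> b a]
      by (cases a b rule: le_cases)
        (auto simp: right_diff_distrib[symmetric] mult_le_0_iff zero_le_mult_iff)
  next
    case 3
    then show ?thesis
      using assms powr_mono2'[of \<alpha> a b] powr_mono2'[of \<alpha> b a]
      by (cases a b rule: le_cases)
        (auto simp: right_diff_distrib[symmetric] mult_le_0_iff zero_le_mult_iff)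
  qed
  assume "(r * a powr \<alpha> - r * b powr \<alpha>) * (ln b - ln a) = 0" "\<alpha> * r \<noteq> 0"
  then have "a powr \<alpha> = b powr \<alpha> \<or> ln a = ln b" "\<alpha> \<noteq> 0"
    by (auto simp: right_diff_distrib[symmetric])
  then show "a = b" using assms by (auto simp: powr_def)
qed

text \<open>The first conclusion makes the two factors proportional, and the second fixes the ratio
  as 1 once \<open>\<alpha> * R\<close> is nonzero at some vertex.\<close>

lemma alpha_curvature_rigidity:
  assumes surf: "triangulated_surface S V F" and d: "PL_metric F d"
    and R: "\<And>v. v \<in> V \<Longrightarrow> \<alpha> * R v \<le> 0"
    and w: "w \<in> conformal_factors V F d" "\<And>v. v \<in> V \<Longrightarrow> alpha_curvature V F d \<alpha> w v = R v"
    and w': "w' \<in> conformal_factors V F d" "\<And>v. v \<in> V \<Longrightarrow> alpha_curvature V F d \<alpha> w' v = R v"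
  shows "u \<in> V \<Longrightarrow> v \<in> V \<Longrightarrow> ln (w' u) - ln (w u) = ln (w' v) - ln (w v)"
    and "v \<in> V \<Longrightarrow> \<alpha> * R v \<noteq> 0 \<Longrightarrow> w v = w' v"
proof -
  have tri: "triangulation S V F" and V: "finite V"
    using surf by (auto simp: triangulated_surface_def marked_surface_def)
  have F: "finite F" using tri by (simp add: triangulation_def)
  have pos: "0 < w v" "0 < w' v" if "v \<in> V" for v
    using that w(1) w'(1) by (auto simp: conformal_factors_def)
  define l l' where "l = vertex_scaling V w d" and "l' = vertex_scaling V w' d"
  define x where "x v = ln (w' v) - ln (w v)" for v
  define D where "D f = (\<Sum>k\<le>2. (face_angle l' f k - face_angle l f k) * x (corner f k))" for f
  define T where "T v = (R v * w v powr \<alpha> - R v * w' v powr \<alpha>) * x v" for v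
  have D: "D f \<le> 0" "D f = 0 \<Longrightarrow> j \<le> 2 \<Longrightarrow> k \<le> 2 \<Longrightarrow> x (corner f j) = x (corner f k)"
    if "f \<in> F" for f j k
    unfolding D_def l_def l'_def x_def
    by (rule face_scaling_monotone[OF tri d that w(1) w'(1)]; assumption)+
  have T: "0 \<le> T v" "T v = 0 \<Longrightarrow> \<alpha> * R v \<noteq> 0 \<Longrightarrow> w v = w' v" if "v \<in> V" for v
    using power_difference_sign[OF pos[OF that] R[OF that]] unfolding T_def x_def by blast+
  have "curvature F l v = R v * w v powr \<alpha>" "curvature F l' v = R v * w' v powr \<alpha>"
    if "v \<in> V" for v
    using w(2)[OF that] w'(2)[OF that] pos[OF that]
    unfolding alpha_curvature_def l_def l'_def by (metis nonzero_eq_divide_eq powr_gt_zero less_irrefl)+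
  \<comment> \<open>The left side has only nonnegative terms and the right side only nonpositive
    ones, so every term on both sides vanishes.\<close>
  then have sum: "sum T V = sum D F"
    using sum_curvature[OF tri V, of l l' x] by (simp add: T_def D_def)
  moreover have "0 \<le> sum T V" using T by (intro sum_nonneg) auto
  moreover have "sum D F \<le> 0" using D by (intro sum_nonpos) auto
  ultimately have "sum T V = 0" "sum D F = 0" by linarith+
  then have T0: "T v = 0" if "v \<in> V" for v
    using sum_nonneg_eq_0_iff[OF V, of T] T that by auto
  have D0: "D f = 0" if "f \<in> F" for f
    using sum_nonneg_eq_0_iff[OF F, of "\<lambda>f. - D f"] D(1) \<open>sum D F = 0\<close> that
    by (simp add: sum_negf)
  show "v \<in> V \<Longrightarrow> \<alpha> * R v \<noteq> 0 \<Longrightarrow> w v = w' v" using T T0 by blast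
  assume uv: "u \<in> V" "v \<in> V"
  show "ln (w' u) - ln (w u) = ln (w' v) - ln (w v)"
    using constant_on_faces_imp_constant[OF surf _ uv, of x] D(2) D0 unfolding x_def by blast
qed

theorem theorem1p2:
  fixes S :: "'a topology" and V :: "'a set" and F :: "'a face set"
    and d :: "'a set \<Rightarrow> real" and \<alpha> :: real and R :: "'a \<Rightarrow> real"
  assumes "triangulated_surface S V F"
    and "PL_metric F d"
    and "\<alpha> * of_int (euler_characteristic V F) \<le> 0"
  shows
    "((\<forall>v\<in>V. \<alpha> * R v = 0) \<longrightarrow>
        (\<forall>wA\<in>conformal_factors V F d. \<forall>wB\<in>conformal_factors V F d.
           (\<forall>v\<in>V. alpha_curvature V F d \<alpha> wA v = R v) \<and>
           (\<forall>v\<in>V. alpha_curvature V F d \<alpha> wB v = R v) \<longrightarrow>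
           (\<exists>c>0. \<forall>v\<in>V. wA v = c * wB v))) \<and>
     ((\<forall>v\<in>V. \<alpha> * R v \<le> 0) \<and> (\<exists>v\<in>V. \<alpha> * R v \<noteq> 0) \<longrightarrow>
        (\<forall>wA\<in>conformal_factors V F d. \<forall>wB\<in>conformal_factors V F d.
           (\<forall>v\<in>V. alpha_curvature V F d \<alpha> wA v = R v) \<and>
           (\<forall>v\<in>V. alpha_curvature V F d \<alpha> wB v = R v) \<longrightarrow>
           (\<forall>v\<in>V. wA v = wB v)))"
proof (intro conjI impI ballI; elim conjE)
  fix wA wB
  assume w: "wA \<in> conformal_factors V F d" "wB \<in> conformal_factors V F d"
    and R: "\<forall>v\<in>V. alpha_curvature V F d \<alpha> wA v = R v" "\<forall>v\<in>V. alpha_curvature V F d \<alpha> wB v = R v"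
  have pos: "0 < wA v" "0 < wB v" if "v \<in> V" for v
    using that w by (auto simp: conformal_factors_def)
  \<comment> \<open>The scaling constant is read off at a base vertex \<open>u\<close>.\<close>
  have ratio: "wA v = wA u / wB u * wB v"
    if "\<forall>v\<in>V. \<alpha> * R v \<le> 0" "u \<in> V" "v \<in> V" for u v
  proof -
    have "ln (wB u) - ln (wA u) = ln (wB v) - ln (wA v)"
      using that R by (intro alpha_curvature_rigidity(1)[where \<alpha> = \<alpha> and R = R, OF assms(1,2) _ w(1) _ w(2)]) auto
    then have "ln (wA v) = ln (wA u / wB u * wB v)"
      using pos[OF that(2)] pos[OF that(3)] by (simp add: ln_mult_pos ln_div)
    then show ?thesis using pos[OF that(2)] pos[OF that(3)] by simp
  qed
  {
    assume "\<forall>v\<in>V. \<alpha> * R v = 0"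
    then have nonpos: "\<forall>v\<in>V. \<alpha> * R v \<le> 0" by (metis order_refl)
    obtain u where u: "u \<in> V"
      using assms(1) by (auto simp: triangulated_surface_def marked_surface_def)
    show "\<exists>c>0. \<forall>v\<in>V. wA v = c * wB v"
    proof (intro exI[of _ "wA u / wB u"] conjI ballI)
      show "0 < wA u / wB u" using pos[OF u] by simp
    qed (rule ratio[OF nonpos u])
  next
    fix v assume nonpos: "\<forall>v\<in>V. \<alpha> * R v \<le> 0" and "\<exists>v\<in>V. \<alpha> * R v \<noteq> 0" and v: "v \<in> V"
    \<comment> \<open>With the base vertex chosen here, the scaling constant is 1.\<close>
    then obtain u where u: "u \<in> V" "\<alpha> * R u \<noteq> 0" by blast
    then have "wA u = wB u"
      using nonpos R by (intro alpha_curvature_rigidity(2)[where \<alpha> = \<alpha> and R = R, OF assms(1,2) _ w(1) _ w(2)]) auto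
    then show "wA v = wB v" using ratio[OF nonpos u(1) v] pos[OF u(1)] by simp
  }
qed

end
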